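(* The following statements about the real field $\mathbb{R}$ are equivalent. (1) [BWP & ES] The conjunction of the Bolzano-Weierstrass Property of $\mathbb{R}$: every bounded sequence has a convergent subsequence; and the Existence of Suprema: every nonempty set of real numbers that has an upper bound has a least upper bound. (2) [EVT] Extreme Value Theorem: given a continuous function $f:[a,b]\to\mathbb{R}$, there exists $c\in[a,b]$ such that for all $x\in[a,b]$, we have $f(x)\le f(c)$. (3) [RT] Rolle's Theorem: if $f$ is continuous on $[a,b]$, differentiable on $(a,b)$, and $f(a)=0=f(b)$, then there exists $c\in(a,b)$ such that $f'(c)=0$. (4) [eMVT] Extended Mean Value Theorem: if $f,g:[a,b]\to\mathbb{R}$ are continuous on $[a,b]$, differentiable on $(a,b)$, and if $g'$ is nonzero on $(a,b)$, then there exists $c\in(a,b)$ such that $\frac{f'(c)}{g'(c)}=\frac{f(b)-f(a)}{g(b)-g(a)}$. (5) [MVT] Mean Value Theorem: if $f:[a,b]\to\mathbb{R}$ is continuous on $[a,b]$ and differentiable on $(a,b)$, then there exists $c\in(a,b)$ such that $f'(c)=\frac{f(b)-f(a)}{b-a}$. (6) Taylor's Theorem (with Lagrange Remainder): let $n$ be a nonnegative integer, and let $f$ be a function $[a,b]\to\mathbb{R}$. Suppose all of $f^{(0)},f^{(1)},f^{(2)},\dots,f^{(n)}$ are continuous on $[a,b]$, and that $f^{(n)}$ is differentiable on $(a,b)$. For any $x\in(a,b]$, there exists $c\in(a,x)$ such that $$f(x)=\left[\sum_{k=0}^n\frac{f^{(k)}(a)}{k!}(x-a)^k\right]+\frac{f^{(n+1)}(c)}{(n+1)!}(x-a)^{n+1}.$$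 (7) [PCP] Polynomial Characterization Property: let $n$ be a nonnegative integer, and let $f$ be a function $[a,b]\to\mathbb{R}$. Suppose all of $f^{(0)},f^{(1)},f^{(2)},\dots,f^{(n)}$ are continuous on $[a,b]$, and that $f^{(n)}$ is differentiable on $(a,b)$. If $f^{(n+1)}$ is zero on $(a,b)$, then $f$ is a polynomial of degree at most $n$. (8) [CFT] Convex Function Theorem: if $f''$ is nonnegative on $(a,b)$, then $a<c<x<b$ implies that for all $t\in[c,x]$, we have $f(t)\le f(c)+(t-c)\frac{f(x)-f(c)}{x-c}$ (that is, $f$ is convex on $(a,b)$). (9) [IFT] Increasing Function Theorem: if $f'$ is nonnegative on $(a,b)$, then $a<c<x<b$ implies $f(c)\le f(x)$ (that is, $f$ is monotonically increasing on $(a,b)$). (10) [CVT] Constant Value Theorem: if $f'$ is zero on $(a,b)$, then $f$ is constant on $(a,b)$. (11) The unit interval $[0,1]$ is connected.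
   Context: The setting is the real field $\mathbb{R}$; any one of the listed principles may be chosen as the completeness axiom for $\mathbb{R}$, and equivalence means that each principle is derived from each other one. $\mathbb{N}=\{1,2,3,\dots\}$. A sequence is a function $\mathbb{N}\to\mathbb{R}$, $(c_n)_{n\in\mathbb{N}}$; it is bounded if some $M>0$ satisfies $|c_n|\le M$ for all $n$; it converges to $c\in\mathbb{R}$ if for every $\varepsilon>0$ there is $N\in\mathbb{N}$ with $|c_n-c|<\varepsilon$ for all $n\ge N$ (convergent: converges to some $c\in\mathbb{R}$). A subsequence is $(c_{N_k})_{k\in\mathbb{N}}$ with $(N_k)_{k\in\mathbb{N}}$ a strictly increasing sequence in $\mathbb{N}$. An upper bound of $S\subseteq\mathbb{R}$ is $b\in\mathbb{R}$ with $x\le b$ for all $x\in S$; a least upper bound is an upper bound $c$ with $c\le b$ for every upper bound $b$. A function $f:X\to\mathbb{R}$, $X\subseteq\mathbb{R}$, is continuous at $c\in X$ if for each $\varepsilon>0$ there is $\delta>0$ such that $x\in X$, $|x-c|<\delta$ imply $|f(x)-f(c)|<\varepsilon$; it is continuous on a set if it is continuous at each point of it. If $c$ is both an element and an interior point of $X$ (some bounded open interval containing $c$ lies in $X$), then $f$ is differentiable at $c$ if $f'(c)=\lim_{x\to c}\frac{f(x)-f(c)}{x-c}$ exists, i.e. there is a (unique) $L=f'(c)\in\mathbb{R}$ such that for each $\varepsilon>0$ there is $\delta>0$ such that $x\in X$, $0<|x-c|<\delta$ imply $\left|\frac{f(x)-f(c)}{x-c}-L\right|<\varepsilon$. The derivative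 of $f$ is the function $f':c\mapsto f'(c)$. Put $f^{(0)}=f$, and let $f^{(k+1)}$ be the derivative of $f^{(k)}$; $f'=f^{(1)}$, $f''=f^{(2)}$. $G\subseteq\mathbb{R}$ is open if for every $x\in G$ there is a bounded open interval $(u,v)$ with $x\in(u,v)\subseteq G$. For $U\subseteq I\subseteq\mathbb{R}$, $U$ is open relative to $I$ if $U=G\cap I$ for some open $G$. $I$ is connected if there do not exist nonempty disjoint subsets $A,B$ of $I$, both open relative to $I$, with $I=A\cup B$. Intervals $[a,b]$ are nonempty, and $a<b$ is understood in (3), (4) and (5). *)

theory Defs
  imports "HOL-Computational_Algebra.Polynomial"
begin

text \<open>
  The completeness of the real field is what the principles below express, so it must not be built
  in.  Each principle is a property of an arbitrary linearly ordered field \<open>'a\<close>, passed as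
  \<open>TYPE('a)\<close>; no Archimedean property is assumed, and all epsilons and deltas range over
  \<open>'a\<close>.  A function \<open>X \<rightarrow> 'a\<close> is a total function together with its domain \<open>X\<close>; every notion
  below depends only on the values on \<open>X\<close>.
\<close>

definition bounded_seq :: "(nat \<Rightarrow> 'a::linordered_field) \<Rightarrow> bool" where
  "bounded_seq s \<longleftrightarrow> (\<exists>M>0. \<forall>n. \<bar>s n\<bar> \<le> M)"

definition converges_to :: "(nat \<Rightarrow> 'a::linordered_field) \<Rightarrow> 'a \<Rightarrow> bool" where
  "converges_to s l \<longleftrightarrow> (\<forall>e>0. \<exists>N. \<forall>n\<ge>N. \<bar>s n - l\<bar> < e)"

definition upper_bound :: "'a::linordered_field set \<Rightarrow> 'a \<Rightarrow> bool" where
  "upper_bound S b \<longleftrightarrow> (\<forall>x\<in>S. x \<le> b)"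

definition least_upper_bound :: "'a::linordered_field set \<Rightarrow> 'a \<Rightarrow> bool" where
  "least_upper_bound S c \<longleftrightarrow> upper_bound S c \<and> (\<forall>b. upper_bound S b \<longrightarrow> c \<le> b)"

definition cont_at :: "'a::linordered_field set \<Rightarrow> ('a \<Rightarrow> 'a) \<Rightarrow> 'a \<Rightarrow> bool" where
  "cont_at X f c \<longleftrightarrow>
     c \<in> X \<and> (\<forall>e>0. \<exists>d>0. \<forall>x\<in>X. \<bar>x - c\<bar> < d \<longrightarrow> \<bar>f x - f c\<bar> < e)"

definition cont_on :: "'a::linordered_field set \<Rightarrow> ('a \<Rightarrow> 'a) \<Rightarrow> 'a set \<Rightarrow> bool" where
  "cont_on X f S \<longleftrightarrow> (\<forall>c\<in>S. cont_at X f c)"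

definition interior_point :: "'a::linordered_field set \<Rightarrow> 'a \<Rightarrow> bool" where
  "interior_point X c \<longleftrightarrow> (\<exists>u v. c \<in> {u<..<v} \<and> {u<..<v} \<subseteq> X)"

text \<open>
  The limit of the difference quotients of \<open>f : X \<rightarrow> 'a\<close> through points of \<open>X\<close>.  At an endpoint of
  \<open>X = {a..b}\<close> with \<open>a < b\<close> this is the one-sided derivative.
\<close>

definition has_deriv_at :: "'a::linordered_field set \<Rightarrow> ('a \<Rightarrow> 'a) \<Rightarrow> 'a \<Rightarrow> 'a \<Rightarrow> bool" where
  "has_deriv_at X f c L \<longleftrightarrow>
     c \<in> X \<and>
     (\<forall>e>0. \<exists>d>0. \<forall>x\<in>X. 0 < \<bar>x - c\<bar> \<and> \<bar>x - c\<bar> < d \<longrightarrow> \<bar>(f x - f c) / (x - c) - L\<bar> < e)"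

definition diff_at :: "'a::linordered_field set \<Rightarrow> ('a \<Rightarrow> 'a) \<Rightarrow> 'a \<Rightarrow> bool" where
  "diff_at X f c \<longleftrightarrow> c \<in> X \<and> interior_point X c \<and> (\<exists>L. has_deriv_at X f c L)"

definition diff_on :: "'a::linordered_field set \<Rightarrow> ('a \<Rightarrow> 'a) \<Rightarrow> 'a set \<Rightarrow> bool" where
  "diff_on X f S \<longleftrightarrow> (\<forall>c\<in>S. diff_at X f c)"

text \<open>The value is meaningful only where the limit exists and is unique.\<close>

definition derivative :: "'a::linordered_field set \<Rightarrow> ('a \<Rightarrow> 'a) \<Rightarrow> 'a \<Rightarrow> 'a" where
  "derivative X f c = (THE L. has_deriv_at X f c L)"

primrec nth_derivative ::
  "'a::linordered_field set \<Rightarrow> ('a \<Rightarrow> 'a) \<Rightarrow> nat \<Rightarrow> 'a \<Rightarrow> 'a" where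
  "nth_derivative X f 0 = f"
| "nth_derivative X f (Suc k) = derivative X (nth_derivative X f k)"

text \<open>
  For \<open>f : {a..b} \<rightarrow> 'a\<close>: the derivatives of order \<open>0, \<dots>, n\<close> are defined and continuous on all of
  \<open>{a..b}\<close> (one-sided at the endpoints), and the \<open>n\<close>-th one is differentiable on the open interval.
  The first conjunct says that the derivatives of order \<open>1, \<dots>, n\<close> exist on \<open>{a..b}\<close>.
\<close>

definition taylor_hyp :: "nat \<Rightarrow> 'a::linordered_field \<Rightarrow> 'a \<Rightarrow> ('a \<Rightarrow> 'a) \<Rightarrow> bool" where
  "taylor_hyp n a b f \<longleftrightarrow>
     (\<forall>k<n. \<forall>c\<in>{a..b}. \<exists>L. has_deriv_at {a..b} (nth_derivative {a..b} f k) c L) \<and>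
     (\<forall>k\<le>n. cont_on {a..b} (nth_derivative {a..b} f k) {a..b}) \<and>
     diff_on {a..b} (nth_derivative {a..b} f n) {a<..<b}"

definition open_set :: "'a::linordered_field set \<Rightarrow> bool" where
  "open_set G \<longleftrightarrow> (\<forall>x\<in>G. \<exists>u v. x \<in> {u<..<v} \<and> {u<..<v} \<subseteq> G)"

definition open_rel :: "'a::linordered_field set \<Rightarrow> 'a set \<Rightarrow> bool" where
  "open_rel I U \<longleftrightarrow> (\<exists>G. open_set G \<and> U = G \<inter> I)"

definition connected_set :: "'a::linordered_field set \<Rightarrow> bool" where
  "connected_set I \<longleftrightarrow>
     \<not> (\<exists>A B. A \<subseteq> I \<and> B \<subseteq> I \<and> A \<noteq> {} \<and> B \<noteq> {} \<and> A \<inter> B = {} \<and>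
            open_rel I A \<and> open_rel I B \<and> I = A \<union> B)"

definition Bolzano_Weierstrass_Property :: "'a::linordered_field itself \<Rightarrow> bool" where
  "Bolzano_Weierstrass_Property (T::'a itself) \<longleftrightarrow>
     (\<forall>s :: nat \<Rightarrow> 'a. bounded_seq s \<longrightarrow>
        (\<exists>r l. strict_mono (r :: nat \<Rightarrow> nat) \<and> converges_to (\<lambda>k. s (r k)) l))"

definition Existence_of_Suprema :: "'a::linordered_field itself \<Rightarrow> bool" where
  "Existence_of_Suprema (T::'a itself) \<longleftrightarrow>
     (\<forall>S :: 'a set. S \<noteq> {} \<and> (\<exists>b. upper_bound S b) \<longrightarrow> (\<exists>c. least_upper_bound S c))"

definition Extreme_Value_Theorem :: "'a::linordered_field itself \<Rightarrow> bool" where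
  "Extreme_Value_Theorem (T::'a itself) \<longleftrightarrow>
     (\<forall>(a::'a) b f. a \<le> b \<and> cont_on {a..b} f {a..b} \<longrightarrow>
        (\<exists>c\<in>{a..b}. \<forall>x\<in>{a..b}. f x \<le> f c))"

definition Rolle_Theorem :: "'a::linordered_field itself \<Rightarrow> bool" where
  "Rolle_Theorem (T::'a itself) \<longleftrightarrow>
     (\<forall>(a::'a) b f. a < b \<and> cont_on {a..b} f {a..b} \<and> diff_on {a..b} f {a<..<b} \<and>
        f a = 0 \<and> f b = 0 \<longrightarrow>
        (\<exists>c\<in>{a<..<b}. derivative {a..b} f c = 0))"

text \<open>
  The conclusion includes that the quotient on the right is defined; the library convention
  \<open>x / 0 = 0\<close> would otherwise give it an unintended meaning.
\<close>

definition Extended_Mean_Value_Theorem :: "'a::linordered_field itself \<Rightarrow> bool" where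
  "Extended_Mean_Value_Theorem (T::'a itself) \<longleftrightarrow>
     (\<forall>(a::'a) b f g. a < b \<and>
        cont_on {a..b} f {a..b} \<and> diff_on {a..b} f {a<..<b} \<and>
        cont_on {a..b} g {a..b} \<and> diff_on {a..b} g {a<..<b} \<and>
        (\<forall>c\<in>{a<..<b}. derivative {a..b} g c \<noteq> 0) \<longrightarrow>
        g b - g a \<noteq> 0 \<and>
        (\<exists>c\<in>{a<..<b}.
           derivative {a..b} f c / derivative {a..b} g c = (f b - f a) / (g b - g a)))"

definition Mean_Value_Theorem :: "'a::linordered_field itself \<Rightarrow> bool" where
  "Mean_Value_Theorem (T::'a itself) \<longleftrightarrow>
     (\<forall>(a::'a) b f. a < b \<and> cont_on {a..b} f {a..b} \<and> diff_on {a..b} f {a<..<b} \<longrightarrow>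
        (\<exists>c\<in>{a<..<b}. derivative {a..b} f c = (f b - f a) / (b - a)))"

definition Taylor_Theorem :: "'a::linordered_field itself \<Rightarrow> bool" where
  "Taylor_Theorem (T::'a itself) \<longleftrightarrow>
     (\<forall>n (a::'a) b f. a \<le> b \<and> taylor_hyp n a b f \<longrightarrow>
        (\<forall>x\<in>{a<..b}. \<exists>c\<in>{a<..<x}.
           f x = (\<Sum>k=0..n. nth_derivative {a..b} f k a / fact k * (x - a) ^ k) +
                 nth_derivative {a..b} f (n + 1) c / fact (n + 1) * (x - a) ^ (n + 1)))"

definition Polynomial_Characterization_Property :: "'a::linordered_field itself \<Rightarrow> bool" where
  "Polynomial_Characterization_Property (T::'a itself) \<longleftrightarrow>
     (\<forall>n (a::'a) b f. a \<le> b \<and> taylor_hyp n a b f \<and>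
        (\<forall>c\<in>{a<..<b}. nth_derivative {a..b} f (n + 1) c = 0) \<longrightarrow>
        (\<exists>p. degree p \<le> n \<and> (\<forall>x\<in>{a..b}. f x = poly p x)))"

text \<open>
  The next three principles concern \<open>f\<close> only on \<open>(a, b)\<close>, which is therefore taken as its domain;
  a function on a larger domain has the same derivatives there as its restriction.
\<close>

definition Convex_Function_Theorem :: "'a::linordered_field itself \<Rightarrow> bool" where
  "Convex_Function_Theorem (T::'a itself) \<longleftrightarrow>
     (\<forall>(a::'a) b f.
        diff_on {a<..<b} f {a<..<b} \<and>
        diff_on {a<..<b} (nth_derivative {a<..<b} f 1) {a<..<b} \<and>
        (\<forall>z\<in>{a<..<b}. 0 \<le> nth_derivative {a<..<b} f 2 z) \<longrightarrow>
        (\<forall>c x. a < c \<and> c < x \<and> x < b \<longrightarrow>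
           (\<forall>t\<in>{c..x}. f t \<le> f c + (t - c) * ((f x - f c) / (x - c)))))"

definition Increasing_Function_Theorem :: "'a::linordered_field itself \<Rightarrow> bool" where
  "Increasing_Function_Theorem (T::'a itself) \<longleftrightarrow>
     (\<forall>(a::'a) b f.
        diff_on {a<..<b} f {a<..<b} \<and> (\<forall>z\<in>{a<..<b}. 0 \<le> derivative {a<..<b} f z) \<longrightarrow>
        (\<forall>c x. a < c \<and> c < x \<and> x < b \<longrightarrow> f c \<le> f x))"

definition Constant_Value_Theorem :: "'a::linordered_field itself \<Rightarrow> bool" where
  "Constant_Value_Theorem (T::'a itself) \<longleftrightarrow>
     (\<forall>(a::'a) b f.
        diff_on {a<..<b} f {a<..<b} \<and> (\<forall>z\<in>{a<..<b}. derivative {a<..<b} f z = 0) \<longrightarrow>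
        (\<exists>k. \<forall>x\<in>{a<..<b}. f x = k))"

definition Unit_Interval_Connected :: "'a::linordered_field itself \<Rightarrow> bool" where
  "Unit_Interval_Connected (T::'a itself) \<longleftrightarrow> connected_set {0..1::'a}"

end

theory Submission imports Defs begin

text \<open>
  All the principles are ways of saying that the ordered field has no gap, that is, no cut into a
  lower and an upper part without a boundary point.

  If a nonempty set that is bounded above has no supremum, the set \<open>L\<close> of those elements that are
  not upper bounds and its complement are both open: a gap (\<open>ES_if_no_gap\<close>).  The function that is
  \<open>0\<close> on \<open>L\<close> and \<open>1\<close> off \<open>L\<close> then is locally constant, so that its derivative is zero everywhere,
  and yet it jumps from \<open>0\<close> to \<open>1\<close> (\<open>gap_step_has_deriv_zero\<close>).  This one function refutes the
  constant value theorem, the polynomial characterization (of degree \<open>0\<close>) and the convex function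
  theorem, and an affine copy of the gap disconnects \<open>[0, 1]\<close>.  Hence each of these principles
  yields suprema.

  Conversely, suprema make local properties global along an interval (\<open>local_imp_global\<close>), which
  gives the extreme value theorem and the connectedness of \<open>[0, 1]\<close>.  From there on the usual proofs
  of differential calculus work over any ordered field, because they use completeness only through
  the principle they start from: an interior extremum has derivative zero, which is Rolle's theorem;
  Rolle's theorem for a linear combination of two functions is Cauchy's mean value theorem
  (\<open>Rolle_imp_Cauchy\<close>); iterating the latter gives Taylor's theorem (\<open>Taylor_zero_expansion\<close>), whose
  remainder vanishes in the polynomial characterization; and the mean value theorem turns a sign of
  the derivative into monotonicity.

  The implications thus form the cycles
  suprema, EVT, Rolle, extended MVT, MVT, Rolle, Taylor, polynomials, suprema;
  MVT, increasing functions, constant functions, suprema;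
  MVT, convex functions, suprema; and suprema, connectedness, suprema.
  The Bolzano-Weierstrass property hangs off the first cycle, as a consequence of suprema.
\<close>

section \<open>Continuity and differentiation over an ordered field\<close>

lemma cont_atD:
  assumes "cont_at X f c" "e > 0"
  obtains d where "d > 0" "\<And>x. x \<in> X \<Longrightarrow> \<bar>x - c\<bar> < d \<Longrightarrow> \<bar>f x - f c\<bar> < e"
  using assms unfolding cont_at_def by blast

lemma cont_at_const: "c \<in> X \<Longrightarrow> cont_at X (\<lambda>x. k) c"
  unfolding cont_at_def using zero_less_one by auto

lemma cont_at_ident: "c \<in> X \<Longrightarrow> cont_at X (\<lambda>x. x) c"
  unfolding cont_at_def by auto

lemma cont_at_subset: "cont_at X f c \<Longrightarrow> c \<in> Y \<Longrightarrow> Y \<subseteq> X \<Longrightarrow> cont_at Y f c"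
  unfolding cont_at_def by (meson subsetD)

lemma cont_at_local:
  fixes c :: "'a::linordered_field"
  assumes g: "cont_at X g c" and "p < c" "c < q"
    and eq: "\<And>x. x \<in> X \<Longrightarrow> p < x \<Longrightarrow> x < q \<Longrightarrow> f x = g x"
  shows "cont_at X f c"
  unfolding cont_at_def
proof (intro conjI allI impI)
  show c: "c \<in> X" using g by (simp add: cont_at_def)
  fix e :: 'a assume "e > 0"
  then obtain d where d: "d > 0" "\<And>x. x \<in> X \<Longrightarrow> \<bar>x - c\<bar> < d \<Longrightarrow> \<bar>g x - g c\<bar> < e"
    using cont_atD[OF g] by metis
  define d' where "d' = min d (min (c - p) (q - c))"
  have "\<bar>f x - f c\<bar> < e" if "x \<in> X" "\<bar>x - c\<bar> < d'" for x
  proof -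
    have "p < x" "x < q" "\<bar>x - c\<bar> < d" using that(2) by (auto simp: d'_def abs_less_iff)
    then show ?thesis using d(2) that(1) eq c \<open>p < c\<close> \<open>c < q\<close> by simp
  qed
  moreover have "d' > 0" using d \<open>p < c\<close> \<open>c < q\<close> by (simp add: d'_def)
  ultimately show "\<exists>d>0. \<forall>x\<in>X. \<bar>x - c\<bar> < d \<longrightarrow> \<bar>f x - f c\<bar> < e" by blast
qed

lemma cont_at_cong:
  fixes c :: "'a::linordered_field"
  assumes "cont_at X g c" "\<And>x. x \<in> X \<Longrightarrow> f x = g x"
  shows "cont_at X f c"
  using cont_at_local[OF assms(1), of "c - 1" "c + 1"] assms(2) by simp

lemma cont_at_add:
  fixes c :: "'a::linordered_field"
  assumes f: "cont_at X f c" and g: "cont_at X g c"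
  shows "cont_at X (\<lambda>x. f x + g x) c"
  unfolding cont_at_def
proof (intro conjI allI impI)
  show "c \<in> X" using f by (simp add: cont_at_def)
  fix e :: 'a assume "e > 0"
  then have "e / 2 > 0" by simp
  obtain d1 where d1: "d1 > 0" "\<And>x. x \<in> X \<Longrightarrow> \<bar>x - c\<bar> < d1 \<Longrightarrow> \<bar>f x - f c\<bar> < e / 2"
    using cont_atD[OF f \<open>e / 2 > 0\<close>] by metis
  obtain d2 where d2: "d2 > 0" "\<And>x. x \<in> X \<Longrightarrow> \<bar>x - c\<bar> < d2 \<Longrightarrow> \<bar>g x - g c\<bar> < e / 2"
    using cont_atD[OF g \<open>e / 2 > 0\<close>] by metis
  have "\<bar>f x + g x - (f c + g c)\<bar> < e" if "x \<in> X" "\<bar>x - c\<bar> < min d1 d2" for x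
  proof -
    have "\<bar>(f x - f c) + (g x - g c)\<bar> < e / 2 + e / 2"
      using d1(2)[OF that(1)] d2(2)[OF that(1)] that(2)
      by (intro order_le_less_trans[OF abs_triangle_ineq] add_strict_mono) auto
    then show ?thesis by (simp add: algebra_simps)
  qed
  moreover have "min d1 d2 > 0" using d1 d2 by simp
  ultimately show "\<exists>d>0. \<forall>x\<in>X. \<bar>x - c\<bar> < d \<longrightarrow> \<bar>f x + g x - (f c + g c)\<bar> < e" by blast
qed

lemma cont_at_mult:
  fixes c :: "'a::linordered_field"
  assumes f: "cont_at X f c" and g: "cont_at X g c"
  shows "cont_at X (\<lambda>x. f x * g x) c"
  unfolding cont_at_def
proof (intro conjI allI impI)
  show "c \<in> X" using f by (simp add: cont_at_def)
  fix e :: 'a assume "e > 0"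
  \<comment> \<open>With increments \<open>u\<close>, \<open>v\<close> of \<open>f\<close>, \<open>g\<close> below \<open>h \<le> 1\<close>, the increment \<open>u v + f c v + g c u\<close> of the
     product is below \<open>h + \<bar>f c\<bar> h + \<bar>g c\<bar> h = h B\<close>.\<close>
  define B where "B = 1 + \<bar>f c\<bar> + \<bar>g c\<bar>"
  have "B > 0" unfolding B_def by (simp add: add_pos_nonneg)
  define h where "h = min 1 (e / B)"
  have "h > 0" "h \<le> 1" using \<open>e > 0\<close> \<open>B > 0\<close> by (auto simp: h_def)
  have hB: "h * B \<le> e"
  proof -
    have "h \<le> e / B" by (simp add: h_def)
    then show ?thesis using \<open>B > 0\<close> by (simp add: pos_le_divide_eq)
  qed
  obtain d1 where d1: "d1 > 0" "\<And>x. x \<in> X \<Longrightarrow> \<bar>x - c\<bar> < d1 \<Longrightarrow> \<bar>f x - f c\<bar> < h"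
    using cont_atD[OF f \<open>h > 0\<close>] by metis
  obtain d2 where d2: "d2 > 0" "\<And>x. x \<in> X \<Longrightarrow> \<bar>x - c\<bar> < d2 \<Longrightarrow> \<bar>g x - g c\<bar> < h"
    using cont_atD[OF g \<open>h > 0\<close>] by metis
  have "\<bar>f x * g x - f c * g c\<bar> < e" if "x \<in> X" "\<bar>x - c\<bar> < min d1 d2" for x
  proof -
    let ?u = "f x - f c" and ?v = "g x - g c"
    have u: "\<bar>?u\<bar> < h" and v: "\<bar>?v\<bar> < h"
      using d1(2)[OF that(1)] d2(2)[OF that(1)] that(2) by auto
    have "f x * g x - f c * g c = ?u * ?v + f c * ?v + g c * ?u" by (simp add: algebra_simps)
    then have "\<bar>f x * g x - f c * g c\<bar> \<le> \<bar>?u * ?v\<bar> + \<bar>f c * ?v\<bar> + \<bar>g c * ?u\<bar>"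
      using abs_triangle_ineq[of "?u * ?v + f c * ?v" "g c * ?u"]
        abs_triangle_ineq[of "?u * ?v" "f c * ?v"] by linarith
    also have "\<dots> = \<bar>?u\<bar> * \<bar>?v\<bar> + \<bar>f c\<bar> * \<bar>?v\<bar> + \<bar>g c\<bar> * \<bar>?u\<bar>" by (simp add: abs_mult)
    also have "\<dots> < h + \<bar>f c\<bar> * h + \<bar>g c\<bar> * h"
    proof -
      have "\<bar>?u\<bar> * \<bar>?v\<bar> \<le> \<bar>?u\<bar> * 1"
        using v \<open>h \<le> 1\<close> by (intro mult_left_mono) auto
      moreover have "\<bar>f c\<bar> * \<bar>?v\<bar> \<le> \<bar>f c\<bar> * h" "\<bar>g c\<bar> * \<bar>?u\<bar> \<le> \<bar>g c\<bar> * h"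
        using u v by (auto intro!: mult_left_mono)
      ultimately show ?thesis using u by linarith
    qed
    also have "\<dots> = h * B" by (simp add: B_def algebra_simps)
    finally show ?thesis using hB by simp
  qed
  moreover have "min d1 d2 > 0" using d1 d2 by simp
  ultimately show "\<exists>d>0. \<forall>x\<in>X. \<bar>x - c\<bar> < d \<longrightarrow> \<bar>f x * g x - f c * g c\<bar> < e" by blast
qed

definition diff_quot :: "('a::linordered_field \<Rightarrow> 'a) \<Rightarrow> 'a \<Rightarrow> 'a \<Rightarrow> 'a \<Rightarrow> 'a" where
  "diff_quot f c L x = (if x = c then L else (f x - f c) / (x - c))"

lemma diff_quot_mult: "diff_quot f c L x * (x - c) = f x - f c"
  by (simp add: diff_quot_def)

text \<open>
  Caratheodory's form of the derivative: \<open>L\<close> is the derivative at \<open>c\<close> precisely when filling the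
  value \<open>L\<close> into the difference quotient makes it continuous at \<open>c\<close>.  The rules of differentiation
  thereby become algebraic identities between difference quotients, and all the epsilons stay in
  the rules for continuity.
\<close>

lemma has_deriv_at_iff_cont: "has_deriv_at X f c L \<longleftrightarrow> cont_at X (diff_quot f c L) c"
proof -
  have "(0 < \<bar>x - c\<bar> \<and> \<bar>x - c\<bar> < d \<longrightarrow> \<bar>(f x - f c) / (x - c) - L\<bar> < e) \<longleftrightarrow>
        (\<bar>x - c\<bar> < d \<longrightarrow> \<bar>diff_quot f c L x - diff_quot f c L c\<bar> < e)" if "e > 0" for x d e
    using that by (auto simp: diff_quot_def)
  then show ?thesis
    unfolding has_deriv_at_def cont_at_def
    by (rule_tac conj_cong[OF refl], rule_tac all_cong1, rule_tac imp_cong[OF refl],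
      rule_tac ex_cong1, rule_tac conj_cong[OF refl], rule_tac ball_cong[OF refl])
qed

lemma has_deriv_at_imp_mem: "has_deriv_at X f c L \<Longrightarrow> c \<in> X"
  by (simp add: has_deriv_at_def)

lemma has_deriv_at_imp_cont_at:
  assumes "has_deriv_at X f c L"
  shows "cont_at X f c"
proof -
  have c: "c \<in> X" using assms by (rule has_deriv_at_imp_mem)
  have "cont_at X (\<lambda>x. diff_quot f c L x * (x + - c) + f c) c"
    using assms c unfolding has_deriv_at_iff_cont
    by (intro cont_at_add cont_at_mult cont_at_const cont_at_ident)
  then show ?thesis by (rule cont_at_cong) (simp add: diff_quot_mult)
qed

lemma has_deriv_at_subset:
  "has_deriv_at X f c L \<Longrightarrow> c \<in> Y \<Longrightarrow> Y \<subseteq> X \<Longrightarrow> has_deriv_at Y f c L"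
  unfolding has_deriv_at_iff_cont by (rule cont_at_subset)

lemma has_deriv_at_local:
  assumes "has_deriv_at X g c L" "p < c" "c < q"
    and eq: "\<And>x. x \<in> X \<Longrightarrow> p < x \<Longrightarrow> x < q \<Longrightarrow> f x = g x"
  shows "has_deriv_at X f c L"
proof -
  have "c \<in> X" using assms(1) by (rule has_deriv_at_imp_mem)
  then have "f c = g c" using eq assms(2,3) by blast
  then have "diff_quot f c L x = diff_quot g c L x" if "x \<in> X" "p < x" "x < q" for x
    using that by (simp add: diff_quot_def eq)
  then show ?thesis
    using assms(1) unfolding has_deriv_at_iff_cont by (rule_tac cont_at_local[OF _ assms(2,3)])
qed

lemma has_deriv_at_cong:
  assumes "has_deriv_at X g c L" "\<And>x. x \<in> X \<Longrightarrow> f x = g x"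
  shows "has_deriv_at X f c L"
  using has_deriv_at_local[OF assms(1), of "c - 1" "c + 1"] assms(2) by simp

lemma has_deriv_at_const: "c \<in> X \<Longrightarrow> has_deriv_at X (\<lambda>x. k) c 0"
  unfolding has_deriv_at_iff_cont
  by (rule cont_at_cong[OF cont_at_const]) (auto simp: diff_quot_def)

lemma has_deriv_at_ident: "c \<in> X \<Longrightarrow> has_deriv_at X (\<lambda>x. x) c 1"
  unfolding has_deriv_at_iff_cont
  by (rule cont_at_cong[OF cont_at_const]) (auto simp: diff_quot_def)

lemma has_deriv_at_add:
  assumes "has_deriv_at X f c L" "has_deriv_at X g c M"
  shows "has_deriv_at X (\<lambda>x. f x + g x) c (L + M)"
  using cont_at_add[OF assms[unfolded has_deriv_at_iff_cont]] unfolding has_deriv_at_iff_cont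
  by (rule cont_at_cong) (auto simp: diff_quot_def simp flip: add_divide_distrib)

lemma has_deriv_at_mult:
  assumes f: "has_deriv_at X f c L" and g: "has_deriv_at X g c M"
  shows "has_deriv_at X (\<lambda>x. f x * g x) c (f c * M + L * g c)"
proof -
  have c: "c \<in> X" using f by (rule has_deriv_at_imp_mem)
  have "cont_at X (\<lambda>x. f x * diff_quot g c M x + diff_quot f c L x * g c) c"
    using assms has_deriv_at_imp_cont_at[OF f] c unfolding has_deriv_at_iff_cont
    by (intro cont_at_add cont_at_mult cont_at_const)
  moreover have "diff_quot (\<lambda>x. f x * g x) c (f c * M + L * g c) x =
      f x * diff_quot g c M x + diff_quot f c L x * g c" if "x \<in> X" for x
  proof -
    have "f x * g x - f c * g c = f x * (g x - g c) + (f x - f c) * g c"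
      by (simp add: algebra_simps)
    then show ?thesis by (simp add: diff_quot_def add_divide_distrib)
  qed
  ultimately show ?thesis unfolding has_deriv_at_iff_cont by (rule cont_at_cong)
qed

lemma has_deriv_at_cmult:
  assumes "has_deriv_at X f c L"
  shows "has_deriv_at X (\<lambda>x. k * f x) c (k * L)"
  using has_deriv_at_mult[OF has_deriv_at_const assms] has_deriv_at_imp_mem[OF assms] by simp

lemma has_deriv_at_diff:
  assumes "has_deriv_at X f c L" "has_deriv_at X g c M"
  shows "has_deriv_at X (\<lambda>x. f x - g x) c (L - M)"
  using has_deriv_at_add[OF assms(1) has_deriv_at_cmult[OF assms(2), of "- 1"]] by simp

lemma has_deriv_at_sum:
  assumes "\<And>i. i \<in> I \<Longrightarrow> has_deriv_at X (f i) c (L i)" "c \<in> X"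
  shows "has_deriv_at X (\<lambda>x. \<Sum>i\<in>I. f i x) c (\<Sum>i\<in>I. L i)"
  using assms
  by (induction I rule: infinite_finite_induct) (auto intro: has_deriv_at_add has_deriv_at_const)

lemma has_deriv_at_power:
  fixes a :: "'a::linordered_field"
  assumes "c \<in> X"
  shows "has_deriv_at X (\<lambda>x. (x - a) ^ Suc n) c (of_nat (Suc n) * (c - a) ^ n)"
proof (induction n)
  have lin: "has_deriv_at X (\<lambda>x. x - a) c 1"
    using has_deriv_at_diff[OF has_deriv_at_ident has_deriv_at_const] assms by fastforce
  case 0 show ?case using lin by simp
  case (Suc n)
  show ?case using has_deriv_at_mult[OF lin Suc] by (simp add: algebra_simps)
qed

text \<open>
  Two derivatives \<open>L \<noteq> M\<close> at \<open>c\<close> would be two continuous ways of filling in the difference quotient;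
  these agree at points of \<open>X\<close> arbitrarily close to \<open>c\<close>.
\<close>

lemma derivative_eq:
  fixes c :: "'a::linordered_field"
  assumes "a < b" "{a<..<b} \<subseteq> X" "a \<le> c" "c \<le> b" and L: "has_deriv_at X f c L"
  shows "derivative X f c = L"
  unfolding derivative_def
proof (rule the_equality[where P = "has_deriv_at X f c", OF L], rule ccontr)
  fix M assume M: "has_deriv_at X f c M" and "M \<noteq> L"
  define e where "e = \<bar>M - L\<bar> / 2"
  have "e > 0" using \<open>M \<noteq> L\<close> by (simp add: e_def)
  obtain d1 where d1: "d1 > 0"
    "\<And>x. x \<in> X \<Longrightarrow> \<bar>x - c\<bar> < d1 \<Longrightarrow> \<bar>diff_quot f c L x - diff_quot f c L c\<bar> < e"
    using cont_atD[OF L[unfolded has_deriv_at_iff_cont] \<open>e > 0\<close>] by metis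
  obtain d2 where d2: "d2 > 0"
    "\<And>x. x \<in> X \<Longrightarrow> \<bar>x - c\<bar> < d2 \<Longrightarrow> \<bar>diff_quot f c M x - diff_quot f c M c\<bar> < e"
    using cont_atD[OF M[unfolded has_deriv_at_iff_cont] \<open>e > 0\<close>] by metis
  define d where "d = min d1 d2"
  have "d > 0" using d1 d2 by (simp add: d_def)
  have "\<exists>x\<in>{a<..<b}. x \<noteq> c \<and> \<bar>x - c\<bar> < d"
  proof (cases "c < b")
    case True
    then obtain x where "c < x" "x < min b (c + d)"
      using dense[of c "min b (c + d)"] \<open>d > 0\<close> by auto
    then show ?thesis using assms(3) by (intro bexI[of _ x]) (auto simp: abs_less_iff)
  next
    case False
    then obtain x where "max a (c - d) < x" "x < c"
      using dense[of "max a (c - d)" c] \<open>d > 0\<close> assms(1,4) by auto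
    then show ?thesis using assms(4) by (intro bexI[of _ x]) (auto simp: abs_less_iff)
  qed
  then obtain x where x: "x \<in> X" "x \<noteq> c" "\<bar>x - c\<bar> < d" using assms(2) by auto
  have "\<bar>diff_quot f c L x - L\<bar> < e" "\<bar>diff_quot f c L x - M\<bar> < e"
    using d1(2)[OF x(1)] d2(2)[OF x(1)] x by (auto simp: diff_quot_def d_def)
  then have "\<bar>M - L\<bar> < e + e" by linarith
  then show False by (simp add: e_def)
qed

lemma diff_on_derivative:
  assumes "diff_on X f {a<..<b}" "{a<..<b} \<subseteq> X" "c \<in> {a<..<b}"
  shows "has_deriv_at X f c (derivative X f c)"
proof -
  obtain L where L: "has_deriv_at X f c L" using assms(1,3) unfolding diff_on_def diff_at_def by blast
  moreover have "derivative X f c = L" using derivative_eq[OF _ assms(2) _ _ L] assms(3) by auto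
  ultimately show ?thesis by simp
qed

lemma diff_onI:
  assumes "{a<..<b} \<subseteq> X" "\<And>c. c \<in> {a<..<b} \<Longrightarrow> has_deriv_at X f c (f' c)"
  shows "diff_on X f {a<..<b}"
  unfolding diff_on_def diff_at_def interior_point_def using assms by blast

section \<open>From suprema to the Bolzano-Weierstrass property, extrema and connectedness\<close>

lemma bounded_incseq_converges:
  fixes s :: "nat \<Rightarrow> 'a::linordered_field"
  assumes ES: "Existence_of_Suprema TYPE('a)" and "incseq s" and bd: "\<And>n. s n \<le> M"
  shows "\<exists>l. converges_to s l"
proof -
  have "range s \<noteq> {}" "upper_bound (range s) M" using bd by (auto simp: upper_bound_def)
  then obtain l where l: "least_upper_bound (range s) l"
    using ES unfolding Existence_of_Suprema_def by blast
  have "\<exists>N. \<forall>n\<ge>N. \<bar>s n - l\<bar> < e" if "e > 0" for e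
  proof -
    have "\<not> upper_bound (range s) (l - e)" using l that by (force simp: least_upper_bound_def)
    then obtain N where N: "l - e < s N" by (auto simp: upper_bound_def not_le)
    have "\<bar>s n - l\<bar> < e" if "n \<ge> N" for n
    proof -
      have "s N \<le> s n" using \<open>incseq s\<close> that by (simp add: incseqD)
      moreover have "s n \<le> l" using l by (auto simp: least_upper_bound_def upper_bound_def)
      ultimately show ?thesis using N \<open>e > 0\<close> by (simp add: abs_less_iff)
    qed
    then show ?thesis by blast
  qed
  then show ?thesis unfolding converges_to_def by blast
qed

text \<open>
  Every sequence in a linear order has a monotone subsequence, and a bounded monotone sequence
  converges to its supremum or infimum.  Picking terms closer and closer to a cluster point would
  instead call for a sequence of positive radii tending to zero, which an ordered field may lack.
\<close>

lemma ES_imp_BWP: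
  assumes ES: "Existence_of_Suprema TYPE('a::linordered_field)"
  shows "Bolzano_Weierstrass_Property TYPE('a)"
  unfolding Bolzano_Weierstrass_Property_def
proof (intro allI impI)
  fix s :: "nat \<Rightarrow> 'a" assume "bounded_seq s"
  then obtain M where M: "\<bar>s n\<bar> \<le> M" for n by (auto simp: bounded_seq_def)
  obtain r :: "nat \<Rightarrow> nat" where r: "strict_mono r" "monoseq (\<lambda>n. s (r n))"
    using seq_monosub by blast
  have "\<exists>l. converges_to (\<lambda>n. s (r n)) l"
  proof (cases "incseq (\<lambda>n. s (r n))")
    case True
    then show ?thesis using bounded_incseq_converges[OF ES, of _ M] M by (auto simp: abs_le_iff)
  next
    case False
    then have "decseq (\<lambda>n. s (r n))" using r(2) by (simp add: monoseq_iff)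
    then have "incseq (\<lambda>n. - s (r n))" by (simp add: incseq_def decseq_def)
    then obtain l where "converges_to (\<lambda>n. - s (r n)) l"
      using bounded_incseq_converges[OF ES, of _ M] M by (auto simp: abs_le_iff)
    moreover have "\<bar>- x - l\<bar> = \<bar>x - - l\<bar>" for x :: 'a by linarith
    ultimately have "converges_to (\<lambda>n. s (r n)) (- l)" by (simp add: converges_to_def)
    then show ?thesis by blast
  qed
  then show "\<exists>r l. strict_mono (r :: nat \<Rightarrow> nat) \<and> converges_to (\<lambda>k. s (r k)) l" using r(1) by blast
qed

text \<open>
  The passage from local to global along an interval: the supremum \<open>c\<close> of the points \<open>x\<close> with
  \<open>P a x\<close> is itself such a point, by locality just below \<open>c\<close>, and it can only be \<open>b\<close>, by locality
  just above \<open>c\<close>.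
\<close>

lemma local_imp_global:
  fixes a b :: "'a::linordered_field"
  assumes ES: "Existence_of_Suprema TYPE('a)" and "a \<le> b"
    and trans: "\<And>u v w. P u v \<Longrightarrow> P v w \<Longrightarrow> P u w"
    and local: "\<And>x. x \<in> {a..b} \<Longrightarrow>
      \<exists>p q. p < x \<and> x < q \<and> (\<forall>u\<in>{a..b}. \<forall>v\<in>{a..b}. p < u \<and> u \<le> v \<and> v < q \<longrightarrow> P u v)"
  shows "P a b"
proof -
  define S where "S = {x \<in> {a..b}. P a x}"
  have "a \<in> S" using local[of a] \<open>a \<le> b\<close> by (auto simp: S_def)
  moreover have "upper_bound S b" by (auto simp: S_def upper_bound_def)
  ultimately obtain c where c: "least_upper_bound S c"
    using ES unfolding Existence_of_Suprema_def by blast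
  have ge: "x \<le> c" if "x \<in> S" for x
    using c that by (simp add: least_upper_bound_def upper_bound_def)
  have cab: "c \<in> {a..b}"
    using ge[OF \<open>a \<in> S\<close>] c \<open>upper_bound S b\<close> by (simp add: least_upper_bound_def)
  obtain p q where pq: "p < c" "c < q"
    "\<And>u v. u \<in> {a..b} \<Longrightarrow> v \<in> {a..b} \<Longrightarrow> p < u \<Longrightarrow> u \<le> v \<Longrightarrow> v < q \<Longrightarrow> P u v"
    using local[OF cab] by blast
  have "\<not> upper_bound S p" using c pq(1) by (auto simp: least_upper_bound_def)
  then obtain x where x: "x \<in> S" "p < x" by (auto simp: upper_bound_def not_le)
  have reach: "y \<in> S" if "c \<le> y" "y \<le> b" "y < q" for y
  proof -
    have "P x y" using pq(3)[of x y] x ge[OF x(1)] that cab by (auto simp: S_def)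
    then show ?thesis using trans[of a x y] x that cab by (auto simp: S_def)
  qed
  have "c = b"
  proof (rule ccontr)
    assume "c \<noteq> b"
    then have "c < min b q" using cab pq by auto
    then obtain y where "c < y" "y < min b q" using dense by blast
    then show False using reach[of y] ge[of y] by auto
  qed
  then show ?thesis using reach[of c] pq cab by (auto simp: S_def)
qed

text \<open>
  If no value of \<open>f\<close> were maximal, then near every point \<open>f\<close> would stay strictly below a single value of
  \<open>f\<close>.  Being strictly below a single value passes to adjacent intervals, since the larger of the
  two values serves for both.  Thus it would hold on \<open>[a, b]\<close>, where the value would be below itself.
\<close>

lemma ES_imp_EVT:
  assumes ES: "Existence_of_Suprema TYPE('a::linordered_field)"
  shows "Extreme_Value_Theorem TYPE('a)"
  unfolding Extreme_Value_Theorem_def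
proof (intro allI impI, elim conjE, rule ccontr)
  fix a b :: 'a and f
  assume ab: "a \<le> b" and cont: "cont_on {a..b} f {a..b}"
    and nomax: "\<not> (\<exists>c\<in>{a..b}. \<forall>x\<in>{a..b}. f x \<le> f c)"
  define P where "P = (\<lambda>u v. \<exists>y\<in>{a..b}. \<forall>z\<in>{u..v} \<inter> {a..b}. f z < f y)"
  have "P a b"
  proof (rule local_imp_global[OF ES ab])
    fix u v w assume "P u v" "P v w"
    then obtain y y' where y: "y \<in> {a..b}" "\<forall>z\<in>{u..v} \<inter> {a..b}. f z < f y"
      and y': "y' \<in> {a..b}" "\<forall>z\<in>{v..w} \<inter> {a..b}. f z < f y'" by (auto simp: P_def)
    define m where "m = (if f y \<le> f y' then y' else y)"
    have "m \<in> {a..b}" "f y \<le> f m" "f y' \<le> f m" using y y' by (auto simp: m_def)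
    moreover have "f z < f m" if "z \<in> {u..w} \<inter> {a..b}" for z
    proof (cases "z \<le> v")
      case True
      then have "f z < f y" using that y by simp
      then show ?thesis using \<open>f y \<le> f m\<close> by simp
    next
      case False
      then have "f z < f y'" using that y' by simp
      then show ?thesis using \<open>f y' \<le> f m\<close> by simp
    qed
    ultimately show "P u w" unfolding P_def by blast
  next
    fix x assume x: "x \<in> {a..b}"
    then obtain y where y: "y \<in> {a..b}" "f x < f y" using nomax by (meson not_le)
    then have "f y - f x > 0" by simp
    moreover have "cont_at {a..b} f x" using cont x by (simp add: cont_on_def)
    ultimately obtain d where d: "d > 0"
      "\<And>z. z \<in> {a..b} \<Longrightarrow> \<bar>z - x\<bar> < d \<Longrightarrow> \<bar>f z - f x\<bar> < f y - f x"
      using cont_atD by metis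
    have "P u v" if "x - d < u" "v < x + d" for u v
      unfolding P_def
    proof (intro bexI[OF _ y(1)] ballI)
      fix z assume z: "z \<in> {u..v} \<inter> {a..b}"
      then have "\<bar>z - x\<bar> < d" using that by (auto simp: abs_less_iff)
      then show "f z < f y" using d(2)[of z] z by (auto simp: abs_less_iff)
    qed
    then show "\<exists>p q. p < x \<and> x < q \<and>
        (\<forall>u\<in>{a..b}. \<forall>v\<in>{a..b}. p < u \<and> u \<le> v \<and> v < q \<longrightarrow> P u v)"
      using d(1) by (intro exI[of _ "x - d"] exI[of _ "x + d"]) auto
  qed
  then show False unfolding P_def by blast
qed

text \<open>
  Each of the two relatively open parts contains all points of \<open>[0, 1]\<close> near any of its
  points, so membership in \<open>A\<close> is locally constant; by \<open>local_imp_global\<close> it is constant.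
\<close>

lemma ES_imp_connected:
  assumes ES: "Existence_of_Suprema TYPE('a::linordered_field)"
  shows "Unit_Interval_Connected TYPE('a)"
  unfolding Unit_Interval_Connected_def connected_set_def
proof (intro notI, elim exE conjE)
  fix A B :: "'a set"
  assume nonempty: "A \<noteq> {}" "B \<noteq> {}" and disj: "A \<inter> B = {}"
    and rel: "open_rel {0..1} A" "open_rel {0..1} B" and un: "{0..1} = A \<union> B"
  obtain G H where G: "open_set G" "A = G \<inter> {0..1}" and H: "open_set H" "B = H \<inter> {0..1}"
    using rel by (auto simp: open_rel_def)
  have same: "u \<in> A \<longleftrightarrow> v \<in> A" if "0 \<le> u" "u \<le> v" "v \<le> 1" for u v
  proof (rule local_imp_global[OF ES \<open>u \<le> v\<close>, where P = "\<lambda>u v. u \<in> A \<longleftrightarrow> v \<in> A"])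
    fix x assume x: "x \<in> {u..v}"
    then have "x \<in> {0..1}" using that by auto
    then have "x \<in> G \<or> x \<in> H" using un G(2) H(2) by blast
    then obtain p q where pq: "x \<in> {p<..<q}" "{p<..<q} \<subseteq> G \<or> {p<..<q} \<subseteq> H"
      using G(1) H(1) unfolding open_set_def by meson
    moreover have "{u..v} \<subseteq> {0..1}" using that by auto
    ultimately have side: "{p<..<q} \<inter> {u..v} \<subseteq> A \<or> {p<..<q} \<inter> {u..v} \<subseteq> B"
      unfolding G(2) H(2) by blast
    have "s \<in> A \<longleftrightarrow> t \<in> A"
      if "s \<in> {p<..<q} \<inter> {u..v}" "t \<in> {p<..<q} \<inter> {u..v}" for s t
      using side that disj by blast
    then have "\<forall>s\<in>{u..v}. \<forall>t\<in>{u..v}. p < s \<and> s \<le> t \<and> t < q \<longrightarrow> (s \<in> A) = (t \<in> A)"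
      by simp
    then show "\<exists>p q. p < x \<and> x < q \<and>
        (\<forall>s\<in>{u..v}. \<forall>t\<in>{u..v}. p < s \<and> s \<le> t \<and> t < q \<longrightarrow> (s \<in> A) = (t \<in> A))"
      using pq(1) by auto
  qed auto
  obtain y z where yz: "y \<in> A" "z \<in> B" using nonempty by blast
  then have "y \<in> {0..1}" "z \<in> {0..1}" using un by auto
  then have "z \<in> A" using same[of y z] same[of z y] yz(1) by (cases "y \<le> z") auto
  then show False using disj yz by blast
qed

section \<open>From extrema to the mean value theorems\<close>

lemma interior_max_deriv_zero:
  fixes c :: "'a::linordered_field"
  assumes L: "has_deriv_at {a..b} f c L" and c: "c \<in> {a<..<b}" and max: "\<And>x. x \<in> {a..b} \<Longrightarrow> f x \<le> f c"
  shows "L = 0"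
proof (rule ccontr)
  assume "L \<noteq> 0"
  then have "\<bar>L\<bar> > 0" by simp
  then obtain d where d: "d > 0"
    "\<And>x. x \<in> {a..b} \<Longrightarrow> \<bar>x - c\<bar> < d \<Longrightarrow> \<bar>diff_quot f c L x - diff_quot f c L c\<bar> < \<bar>L\<bar>"
    using cont_atD[OF L[unfolded has_deriv_at_iff_cont]] by metis
  \<comment> \<open>The side on which the sign of \<open>L\<close> makes \<open>f\<close> exceed \<open>f c\<close>.\<close>
  have "\<exists>x\<in>{a..b}. \<bar>x - c\<bar> < d \<and> L * (x - c) > 0"
  proof (cases "L > 0")
    case True
    obtain x where "c < x" "x < min b (c + d)"
      using dense[of c "min b (c + d)"] d(1) c by auto
    then show ?thesis using c True by (intro bexI[of _ x]) (auto simp: abs_less_iff)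
  next
    case False
    obtain x where "max a (c - d) < x" "x < c"
      using dense[of "max a (c - d)" c] d(1) c by auto
    then show ?thesis using c False \<open>L \<noteq> 0\<close>
      by (intro bexI[of _ x]) (auto simp: abs_less_iff intro!: mult_neg_neg)
  qed
  then obtain x where x: "x \<in> {a..b}" "\<bar>x - c\<bar> < d" "L * (x - c) > 0" by blast
  have "\<bar>diff_quot f c L x - L\<bar> < \<bar>L\<bar>" using d(2)[OF x(1,2)] by (simp add: diff_quot_def)
  then have "diff_quot f c L x > 0 \<and> L > 0 \<or> diff_quot f c L x < 0 \<and> L < 0"
    by (auto simp: abs_if split: if_splits)
  then have "diff_quot f c L x * (x - c) > 0"
    using x(3) by (auto simp: zero_less_mult_iff)
  then show False using max[OF x(1)] by (simp add: diff_quot_mult)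
qed

text \<open>
  A maximum or a minimum (a maximum of \<open>- f\<close>) in the interior will do.  If both lie at endpoints,
  \<open>f\<close> vanishes identically, and any interior point is a maximum.
\<close>

lemma EVT_imp_Rolle:
  assumes EVT: "Extreme_Value_Theorem TYPE('a::linordered_field)"
  shows "Rolle_Theorem TYPE('a)"
  unfolding Rolle_Theorem_def
proof (intro allI impI, elim conjE)
  fix a b :: 'a and f
  assume ab: "a < b" and cont: "cont_on {a..b} f {a..b}" and diff: "diff_on {a..b} f {a<..<b}"
    and "f a = 0" "f b = 0"
  have deriv: "has_deriv_at {a..b} f c (derivative {a..b} f c)" if "c \<in> {a<..<b}" for c
    using diff_on_derivative[OF diff _ that] by (simp add: greaterThanLessThan_subseteq_atLeastAtMost_iff)
  have neg: "has_deriv_at {a..b} (\<lambda>x. - f x) c (- derivative {a..b} f c)" if "c \<in> {a<..<b}" for c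
    using has_deriv_at_cmult[OF deriv[OF that], of "- 1"] by simp
  have "cont_on {a..b} (\<lambda>x. - f x) {a..b}"
    using cont cont_at_mult[OF cont_at_const, of _ "{a..b}" f "- 1"] by (simp add: cont_on_def)
  then obtain m where m: "m \<in> {a..b}" "\<forall>x\<in>{a..b}. - f x \<le> - f m"
    using EVT ab unfolding Extreme_Value_Theorem_def by (metis order_less_imp_le)
  obtain M where M: "M \<in> {a..b}" "\<forall>x\<in>{a..b}. f x \<le> f M"
    using EVT ab cont unfolding Extreme_Value_Theorem_def by (metis order_less_imp_le)
  obtain z where z: "z \<in> {a<..<b}" using dense[OF ab] by auto
  consider "M \<in> {a<..<b}" | "m \<in> {a<..<b}" | "f M = 0" "f m = 0"
    using M(1) m(1) \<open>f a = 0\<close> \<open>f b = 0\<close> by (metis atLeastAtMost_iff greaterThanLessThan_iff order_le_less)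
  then show "\<exists>c\<in>{a<..<b}. derivative {a..b} f c = 0"
  proof cases
    case 1
    then show ?thesis using interior_max_deriv_zero[OF deriv[OF 1] 1] M by auto
  next
    case 2
    then show ?thesis using interior_max_deriv_zero[OF neg[OF 2] 2] m by auto
  next
    case 3
    then have "f x = 0" if "x \<in> {a..b}" for x
      using M(2) m(2) that by (metis neg_le_iff_le order_antisym)
    then show ?thesis using interior_max_deriv_zero[OF deriv[OF z] z] z by auto
  qed
qed

text \<open>
  Cauchy's mean value theorem in product form; with the identity in place of \<open>g\<close> it is the mean
  value theorem.  The combination \<open>h\<close> of \<open>f\<close> and \<open>g\<close> has equal values at \<open>a\<close> and \<open>b\<close>, and the constant
  \<open>C\<close> makes them zero.  The derivatives enter as functions \<open>f'\<close> and \<open>g'\<close>, since in Taylor's theorem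
  they are derivatives on a domain larger than \<open>{a..b}\<close>.
\<close>

lemma Rolle_imp_Cauchy:
  fixes f :: "'a::linordered_field \<Rightarrow> 'a"
  assumes RT: "Rolle_Theorem TYPE('a)" and ab: "a < b"
    and cf: "\<And>x. x \<in> {a..b} \<Longrightarrow> cont_at {a..b} f x" and cg: "\<And>x. x \<in> {a..b} \<Longrightarrow> cont_at {a..b} g x"
    and df: "\<And>x. x \<in> {a<..<b} \<Longrightarrow> has_deriv_at {a..b} f x (f' x)"
    and dg: "\<And>x. x \<in> {a<..<b} \<Longrightarrow> has_deriv_at {a..b} g x (g' x)"
  shows "\<exists>c\<in>{a<..<b}. (f b - f a) * g' c = (g b - g a) * f' c"
proof -
  define A B C where "A = g b - g a" and "B = - (f b - f a)" and "C = - (A * f a + B * g a)"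
  define h where "h = (\<lambda>x. A * f x + B * g x + C)"
  have "cont_on {a..b} h {a..b}"
    unfolding cont_on_def h_def using cf cg by (auto intro!: cont_at_add cont_at_mult cont_at_const)
  moreover have dh: "has_deriv_at {a..b} h x (A * f' x + B * g' x + 0)" if "x \<in> {a<..<b}" for x
    unfolding h_def using that
    by (intro has_deriv_at_add has_deriv_at_cmult has_deriv_at_const df dg) auto
  moreover have sub: "{a<..<b} \<subseteq> {a..b}" by auto
  ultimately have "\<exists>c\<in>{a<..<b}. derivative {a..b} h c = 0"
    using RT ab diff_onI[OF sub dh] unfolding Rolle_Theorem_def
    by (simp add: h_def A_def B_def C_def algebra_simps)
  then obtain c where c: "c \<in> {a<..<b}" "derivative {a..b} h c = 0" by blast
  then have "A * f' c + B * g' c + 0 = 0"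
    using derivative_eq[OF ab sub _ _ dh[OF c(1)]] by simp
  then show ?thesis using c(1) by (intro bexI[of _ c]) (auto simp: A_def B_def algebra_simps)
qed

lemma Rolle_imp_eMVT:
  assumes RT: "Rolle_Theorem TYPE('a::linordered_field)"
  shows "Extended_Mean_Value_Theorem TYPE('a)"
  unfolding Extended_Mean_Value_Theorem_def
proof (intro allI impI, elim conjE)
  fix a b :: 'a and f g
  let ?f' = "derivative {a..b} f" and ?g' = "derivative {a..b} g"
  assume ab: "a < b" and cont: "cont_on {a..b} f {a..b}" "cont_on {a..b} g {a..b}"
    and diff: "diff_on {a..b} f {a<..<b}" "diff_on {a..b} g {a<..<b}"
    and nz: "\<forall>c\<in>{a<..<b}. ?g' c \<noteq> 0"
  have sub: "{a<..<b} \<subseteq> {a..b}" by auto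
  have c: "cont_at {a..b} f x" "cont_at {a..b} g x" "cont_at {a..b} (\<lambda>x. x) x" if "x \<in> {a..b}" for x
    using cont that by (auto simp: cont_on_def cont_at_ident)
  have d: "has_deriv_at {a..b} f x (?f' x)" "has_deriv_at {a..b} g x (?g' x)"
    "has_deriv_at {a..b} (\<lambda>x. x) x 1" if "x \<in> {a<..<b}" for x
    using diff that sub by (auto intro: diff_on_derivative has_deriv_at_ident)
  \<comment> \<open>The mean value theorem for \<open>g\<close>: were \<open>g b = g a\<close>, its derivative would vanish somewhere.\<close>
  obtain y where y: "y \<in> {a<..<b}" "(g b - g a) * 1 = (b - a) * ?g' y"
    using Rolle_imp_Cauchy[OF RT ab c(2) c(3) d(2) d(3)] by blast
  then have gnz: "g b - g a \<noteq> 0" using nz ab by auto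
  obtain z where z: "z \<in> {a<..<b}" "(f b - f a) * ?g' z = (g b - g a) * ?f' z"
    using Rolle_imp_Cauchy[OF RT ab c(1) c(2) d(1) d(2)] by blast
  then have "?f' z / ?g' z = (f b - f a) / (g b - g a)"
    using gnz nz by (simp add: field_simps)
  then show "g b - g a \<noteq> 0 \<and> (\<exists>c\<in>{a<..<b}. ?f' c / ?g' c = (f b - f a) / (g b - g a))"
    using gnz z(1) by blast
qed

lemma eMVT_imp_MVT:
  assumes eMVT: "Extended_Mean_Value_Theorem TYPE('a::linordered_field)"
  shows "Mean_Value_Theorem TYPE('a)"
  unfolding Mean_Value_Theorem_def
proof (intro allI impI, elim conjE)
  fix a b :: 'a and f
  assume ab: "a < b" and f: "cont_on {a..b} f {a..b}" "diff_on {a..b} f {a<..<b}"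
  have sub: "{a<..<b} \<subseteq> {a..b}" by auto
  have d: "has_deriv_at {a..b} (\<lambda>x. x) c 1" if "c \<in> {a<..<b}" for c
    using that by (intro has_deriv_at_ident) auto
  have one: "derivative {a..b} (\<lambda>x. x) c = 1" if "c \<in> {a<..<b}" for c
    using that derivative_eq[OF ab sub _ _ d] by auto
  have "cont_on {a..b} (\<lambda>x. x) {a..b}" by (simp add: cont_on_def cont_at_ident)
  then have "\<exists>c\<in>{a<..<b}. derivative {a..b} f c / derivative {a..b} (\<lambda>x. x) c = (f b - f a) / (b - a)"
    using eMVT ab f diff_onI[OF sub d] one unfolding Extended_Mean_Value_Theorem_def
    by (metis zero_neq_one)
  then show "\<exists>c\<in>{a<..<b}. derivative {a..b} f c = (f b - f a) / (b - a)" using one by auto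
qed

lemma MVT_imp_Rolle: "Mean_Value_Theorem TYPE('a::linordered_field) \<Longrightarrow> Rolle_Theorem TYPE('a)"
  unfolding Mean_Value_Theorem_def Rolle_Theorem_def by fastforce

section \<open>Taylor's theorem and polynomials\<close>

text \<open>
  The case of Taylor's theorem in which the Taylor polynomial at \<open>a\<close> vanishes.  Cauchy's mean value
  theorem for \<open>F 0\<close> and the power \<open>(x - a) ^ Suc n\<close> replaces the ratio of these two by the ratio of
  their derivatives at some \<open>y\<close> between \<open>a\<close> and \<open>x\<close>, which is the same situation with \<open>n\<close> lowered by
  one; hence the induction.  The successive derivatives form a sequence \<open>F\<close> so that the induction
  step is just a shift of the index.
\<close>

lemma Taylor_zero_expansion:
  fixes F :: "nat \<Rightarrow> 'a::linordered_field \<Rightarrow> 'a"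
  assumes RT: "Rolle_Theorem TYPE('a)" and "a < x"
    and "\<And>k c. k < n \<Longrightarrow> c \<in> {a..x} \<Longrightarrow> has_deriv_at {a..x} (F k) c (F (Suc k) c)"
    and "\<And>c. c \<in> {a..x} \<Longrightarrow> cont_at {a..x} (F n) c"
    and "\<And>c. c \<in> {a<..<x} \<Longrightarrow> has_deriv_at {a..x} (F n) c (F (Suc n) c)"
    and "\<And>k. k \<le> n \<Longrightarrow> F k a = 0"
  shows "\<exists>c\<in>{a<..<x}. F 0 x = F (Suc n) c / fact (Suc n) * (x - a) ^ Suc n"
  using assms(2-)
proof (induction n arbitrary: x F)
  case 0
  have "\<exists>c\<in>{a<..<x}. (F 0 x - F 0 a) * 1 = (x - a) * F (Suc 0) c"
    using 0 by (intro Rolle_imp_Cauchy[OF RT]) (auto intro: cont_at_ident has_deriv_at_ident)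
  then show ?case using 0 by (simp add: mult.commute)
next
  case (Suc n)
  let ?m = "of_nat (Suc (Suc n)) :: 'a"
  have cF: "cont_at {a..x} (F 0) c" if "c \<in> {a..x}" for c
    using Suc.prems(2)[of 0 c] that by (auto intro: has_deriv_at_imp_cont_at)
  have dpow: "has_deriv_at {a..x} (\<lambda>x. (x - a) ^ Suc (Suc n)) c (?m * (c - a) ^ Suc n)"
    if "c \<in> {a..x}" for c
    using has_deriv_at_power[OF that] .
  have "\<exists>y\<in>{a<..<x}. (F 0 x - F 0 a) * (?m * (y - a) ^ Suc n) =
      ((x - a) ^ Suc (Suc n) - (a - a) ^ Suc (Suc n)) * F (Suc 0) y"
    using Suc.prems(1,2) cF
    by (intro Rolle_imp_Cauchy[OF RT])
      (auto simp del: power_Suc of_nat_Suc intro: dpow has_deriv_at_imp_cont_at[OF dpow])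
  then obtain y where y: "y \<in> {a<..<x}"
    "F 0 x * (?m * (y - a) ^ Suc n) = (x - a) ^ Suc (Suc n) * F (Suc 0) y"
    using Suc.prems(5)[of 0] by auto
  have sub: "{a..y} \<subseteq> {a..x}" using y(1) by auto
  have "\<exists>c\<in>{a<..<y}. F (Suc 0) y = F (Suc (Suc n)) c / fact (Suc n) * (y - a) ^ Suc n"
  proof (rule Suc.IH[where F = "\<lambda>k. F (Suc k)"])
    show "a < y" using y(1) by simp
    show "has_deriv_at {a..y} (F (Suc k)) c (F (Suc (Suc k)) c)" if "k < n" "c \<in> {a..y}" for k c
      using Suc.prems(2)[of "Suc k" c] that sub has_deriv_at_subset by fastforce
    show "cont_at {a..y} (F (Suc n)) c" if "c \<in> {a..y}" for c
      using Suc.prems(3)[of c] that sub cont_at_subset by blast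
    show "has_deriv_at {a..y} (F (Suc n)) c (F (Suc (Suc n)) c)" if "c \<in> {a<..<y}" for c
      using Suc.prems(4)[of c] that y(1) sub by (intro has_deriv_at_subset[OF _ _ sub]) auto
    show "F (Suc k) a = 0" if "k \<le> n" for k using Suc.prems(5)[of "Suc k"] that by simp
  qed
  then obtain c where c: "c \<in> {a<..<y}"
    "F (Suc 0) y = F (Suc (Suc n)) c / fact (Suc n) * (y - a) ^ Suc n" by blast
  have "(y - a) ^ Suc n \<noteq> 0" using y(1) by simp
  moreover have "(F 0 x * ?m) * (y - a) ^ Suc n =
      ((x - a) ^ Suc (Suc n) * (F (Suc (Suc n)) c / fact (Suc n))) * (y - a) ^ Suc n"
    using y(2) c(2) by (simp only: mult.assoc)
  ultimately have "F 0 x * ?m = (x - a) ^ Suc (Suc n) * (F (Suc (Suc n)) c / fact (Suc n))"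
    by (simp only: mult_cancel_right) simp
  moreover have "?m \<noteq> 0" by (rule of_nat_neq_0)
  ultimately have "F 0 x = (x - a) ^ Suc (Suc n) * (F (Suc (Suc n)) c / fact (Suc n)) / ?m"
    by (simp only: eq_divide_eq) simp
  also have "\<dots> = F (Suc (Suc n)) c / fact (Suc (Suc n)) * (x - a) ^ Suc (Suc n)"
    by (simp only: fact_Suc[of "Suc n"] of_nat_mult) (simp add: mult.commute del: fact_Suc of_nat_Suc power_Suc)
  finally show ?case using c(1) y(1) by (intro bexI[of _ c]) auto
qed

text \<open>
  The length \<open>m\<close> counts the coefficients, so that differentiating shortens \<open>m\<close> by one and shifts \<open>D\<close>,
  down to the zero function at \<open>m = 0\<close>.
\<close>

definition taylor_poly :: "nat \<Rightarrow> 'a::linordered_field \<Rightarrow> (nat \<Rightarrow> 'a) \<Rightarrow> 'a \<Rightarrow> 'a" where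
  "taylor_poly m a D x = (\<Sum>j<m. D j / fact j * (x - a) ^ j)"

lemma taylor_poly_at_base: "taylor_poly (Suc m) a D a = D 0"
  unfolding taylor_poly_def by (subst sum.lessThan_Suc_shift) simp

lemma taylor_poly_has_deriv:
  assumes "c \<in> X"
  shows "has_deriv_at X (taylor_poly (Suc m) a D) c (taylor_poly m a (\<lambda>j. D (Suc j)) c)"
proof -
  have summand: "has_deriv_at X (\<lambda>x. D (Suc j) / fact (Suc j) * (x - a) ^ Suc j) c
      (D (Suc j) / fact j * (c - a) ^ j)" for j
  proof -
    have "D (Suc j) / fact (Suc j) * (of_nat (Suc j) * (c - a) ^ j) = D (Suc j) / fact j * (c - a) ^ j"
      using of_nat_neq_0[of j, where 'a = 'a]
      by (simp only: fact_Suc of_nat_mult) (simp del: of_nat_Suc)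
    then show ?thesis
      using has_deriv_at_cmult[OF has_deriv_at_power[OF assms, of a j], of "D (Suc j) / fact (Suc j)"]
      by simp
  qed
  have "has_deriv_at X (\<lambda>x. D 0 + (\<Sum>j<m. D (Suc j) / fact (Suc j) * (x - a) ^ Suc j)) c
      (0 + (\<Sum>j<m. D (Suc j) / fact j * (c - a) ^ j))"
    by (intro has_deriv_at_add has_deriv_at_const has_deriv_at_sum summand assms)
  then show ?thesis
    by (rule_tac has_deriv_at_cong)
      (auto simp: taylor_poly_def sum.lessThan_Suc_shift simp del: sum.lessThan_Suc power_Suc fact_Suc)
qed

text \<open>
  Subtracting the Taylor polynomial and its derivatives \<open>P k\<close> reduces the theorem to
  \<open>Taylor_zero_expansion\<close>.  The derivative of order \<open>n + 1\<close> is unaffected, since \<open>P (n + 1) = 0\<close>.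
\<close>

lemma Rolle_imp_Taylor:
  assumes RT: "Rolle_Theorem TYPE('a::linordered_field)"
  shows "Taylor_Theorem TYPE('a)"
  unfolding Taylor_Theorem_def
proof (intro allI impI ballI, elim conjE)
  fix n and a b x :: 'a and f
  assume hyp: "taylor_hyp n a b f" and x: "x \<in> {a<..b}"
  let ?D = "nth_derivative {a..b} f"
  have ab: "a < b" and sub: "{a..x} \<subseteq> {a..b}" and osub: "{a<..<b} \<subseteq> {a..b}" using x by auto
  define P where "P = (\<lambda>k. taylor_poly (Suc n - k) a (\<lambda>j. ?D (k + j) a))"
  have dP: "has_deriv_at {a..x} (P k) c (P (Suc k) c)" if "k \<le> n" "c \<in> {a..x}" for k c
    using taylor_poly_has_deriv[OF that(2), of "n - k" a "\<lambda>j. ?D (k + j) a"] that(1)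
    by (simp add: P_def Suc_diff_le)
  have P_a: "P k a = ?D k a" if "k \<le> n" for k
    using that by (simp add: P_def Suc_diff_le taylor_poly_at_base)
  have dD: "has_deriv_at {a..x} (?D k) c (?D (Suc k) c)" if "k < n" "c \<in> {a..x}" for k c
  proof -
    have c: "a \<le> c" "c \<le> b" using that(2) x by auto
    have "\<forall>k<n. \<forall>c\<in>{a..b}. \<exists>L. has_deriv_at {a..b} (?D k) c L"
      using hyp by (simp add: taylor_hyp_def)
    moreover have "c \<in> {a..b}" using c by simp
    ultimately have "\<exists>L. has_deriv_at {a..b} (?D k) c L" using that(1) by blast
    then obtain L where L: "has_deriv_at {a..b} (?D k) c L" by blast
    moreover have "?D (Suc k) c = L" using derivative_eq[OF ab osub c L] by simp
    ultimately show ?thesis using has_deriv_at_subset[OF _ that(2) sub] by simp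
  qed
  have cD: "cont_at {a..x} (?D n) c" if "c \<in> {a..x}" for c
  proof -
    have "cont_on {a..b} (?D n) {a..b}" using hyp by (simp add: taylor_hyp_def)
    then have "cont_at {a..b} (?D n) c" using that sub by (auto simp: cont_on_def)
    then show ?thesis using that sub by (rule cont_at_subset)
  qed
  have dDn: "has_deriv_at {a..x} (?D n) c (?D (Suc n) c)" if "c \<in> {a<..<x}" for c
  proof -
    have "diff_on {a..b} (?D n) {a<..<b}" using hyp by (simp add: taylor_hyp_def)
    then have "has_deriv_at {a..b} (?D n) c (?D (Suc n) c)"
      using diff_on_derivative[OF _ osub] that x by simp
    then show ?thesis using that by (intro has_deriv_at_subset[OF _ _ sub]) auto
  qed
  define F where "F = (\<lambda>k c. ?D k c + - 1 * P k c)"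
  have "\<exists>c\<in>{a<..<x}. F 0 x = F (Suc n) c / fact (Suc n) * (x - a) ^ Suc n"
  proof (rule Taylor_zero_expansion[OF RT])
    show "a < x" using x by simp
    show "has_deriv_at {a..x} (F k) c (F (Suc k) c)" if "k < n" "c \<in> {a..x}" for k c
      unfolding F_def using that by (intro has_deriv_at_add has_deriv_at_cmult dD dP) auto
    show "cont_at {a..x} (F n) c" if "c \<in> {a..x}" for c
      unfolding F_def using that
      by (intro cont_at_add cont_at_mult cont_at_const cD has_deriv_at_imp_cont_at[OF dP]) auto
    show "has_deriv_at {a..x} (F n) c (F (Suc n) c)" if "c \<in> {a<..<x}" for c
      unfolding F_def using that by (intro has_deriv_at_add has_deriv_at_cmult dDn dP) auto
    show "F k a = 0" if "k \<le> n" for k using P_a[OF that] by (simp add: F_def)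
  qed
  moreover have "F 0 x = f x - (\<Sum>k=0..n. ?D k a / fact k * (x - a) ^ k)"
    by (simp add: F_def P_def taylor_poly_def atLeast0AtMost lessThan_Suc_atMost)
  moreover have "F (Suc n) c = ?D (n + 1) c" for c by (simp add: F_def P_def taylor_poly_def)
  ultimately show "\<exists>c\<in>{a<..<x}. f x = (\<Sum>k=0..n. ?D k a / fact k * (x - a) ^ k) +
      ?D (n + 1) c / fact (n + 1) * (x - a) ^ (n + 1)"
    by (simp only: Suc_eq_plus1) (metis add.commute diff_add_cancel)
qed

lemma Taylor_imp_PCP:
  assumes TT: "Taylor_Theorem TYPE('a::linordered_field)"
  shows "Polynomial_Characterization_Property TYPE('a)"
  unfolding Polynomial_Characterization_Property_def
proof (intro allI impI, elim conjE)
  fix n and a b :: 'a and f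
  let ?D = "nth_derivative {a..b} f"
  assume ab: "a \<le> b" and hyp: "taylor_hyp n a b f" and zero: "\<forall>c\<in>{a<..<b}. ?D (n + 1) c = 0"
  define p where "p = (\<Sum>k=0..n. smult (?D k a / fact k) ([:- a, 1:] ^ k))"
  have "degree p \<le> n" unfolding p_def
  proof (rule degree_sum_le)
    fix k assume "k \<in> {0..n}"
    moreover have "degree ([:- a, 1:] ^ k) \<le> degree [:- a, 1:] * k" by (rule degree_power_le)
    ultimately show "degree (smult (?D k a / fact k) ([:- a, 1:] ^ k)) \<le> n"
      using degree_smult_le[of "?D k a / fact k" "[:- a, 1:] ^ k"] by simp
  qed simp
  moreover have p: "poly p x = (\<Sum>k=0..n. ?D k a / fact k * (x - a) ^ k)" for x
    by (simp add: p_def poly_sum algebra_simps)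
  have "f x = poly p x" if x: "x \<in> {a..b}" for x
  proof (cases "x = a")
    case True
    then show ?thesis unfolding p by (simp add: sum.atLeast_Suc_atMost)
  next
    case False
    then have "x \<in> {a<..b}" using x by simp
    then have "\<exists>c\<in>{a<..<x}. f x = poly p x + ?D (n + 1) c / fact (n + 1) * (x - a) ^ (n + 1)"
      using TT ab hyp unfolding Taylor_Theorem_def p by blast
    then obtain c where c: "c \<in> {a<..<x}"
      "f x = poly p x + ?D (n + 1) c / fact (n + 1) * (x - a) ^ (n + 1)" by blast
    have "?D (n + 1) c = 0" using zero c(1) x by simp
    with c(2) show ?thesis by simp
  qed
  ultimately show "\<exists>p. degree p \<le> n \<and> (\<forall>x\<in>{a..b}. f x = poly p x)" by blast
qed

section \<open>Monotone, convex and constant functions\<close>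

text \<open>
  The monotonicity principles speak of functions on an open interval and the mean value theorem of
  functions on a closed one; derivatives restrict from the larger domain to the smaller.
\<close>

lemma MVT_on_subinterval:
  fixes f :: "'a::linordered_field \<Rightarrow> 'a"
  assumes MVT: "Mean_Value_Theorem TYPE('a)" and ab: "a < b" and sub: "{a..b} \<subseteq> X"
    and d: "\<And>x. x \<in> {a..b} \<Longrightarrow> has_deriv_at X f x (f' x)"
  shows "\<exists>c\<in>{a<..<b}. f' c = (f b - f a) / (b - a)"
proof -
  have d': "has_deriv_at {a..b} f x (f' x)" if "x \<in> {a..b}" for x
    using has_deriv_at_subset[OF d[OF that] that sub] .
  have osub: "{a<..<b} \<subseteq> {a..b}" by auto
  have "derivative {a..b} f x = f' x" if "x \<in> {a<..<b}" for x
    using derivative_eq[OF ab osub _ _ d'] that by auto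
  moreover have "cont_on {a..b} f {a..b}" using has_deriv_at_imp_cont_at[OF d'] by (simp add: cont_on_def)
  moreover have "diff_on {a..b} f {a<..<b}" using d' osub by (intro diff_onI[OF osub, of f f']) auto
  ultimately show ?thesis using MVT ab unfolding Mean_Value_Theorem_def by metis
qed

lemma MVT_imp_IFT:
  assumes MVT: "Mean_Value_Theorem TYPE('a::linordered_field)"
  shows "Increasing_Function_Theorem TYPE('a)"
  unfolding Increasing_Function_Theorem_def
proof (intro allI impI, elim conjE)
  fix a b c x :: 'a and f
  let ?I = "{a<..<b}"
  assume diff: "diff_on ?I f ?I" and nonneg: "\<forall>z\<in>?I. 0 \<le> derivative ?I f z"
    and "a < c" "c < x" "x < b"
  then have sub: "{c..x} \<subseteq> ?I" by auto
  have d: "has_deriv_at ?I f z (derivative ?I f z)" if "z \<in> {c..x}" for z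
    using that sub by (intro diff_on_derivative[OF diff]) auto
  obtain z where z: "z \<in> {c<..<x}" "derivative ?I f z = (f x - f c) / (x - c)"
    using MVT_on_subinterval[OF MVT \<open>c < x\<close> sub d] by blast
  moreover have "0 \<le> derivative ?I f z" using nonneg z(1) \<open>a < c\<close> \<open>x < b\<close> by auto
  ultimately show "f c \<le> f x" using \<open>c < x\<close> by (simp add: zero_le_divide_iff)
qed

text \<open>
  The slopes of \<open>f\<close> over \<open>[c, t]\<close> and \<open>[t, x]\<close> are values of \<open>f'\<close> at points in this order, and \<open>f'\<close> is
  increasing; so the first slope is at most the second, which is convexity at \<open>t\<close>.
\<close>

lemma MVT_imp_CFT:
  assumes MVT: "Mean_Value_Theorem TYPE('a::linordered_field)"
  shows "Convex_Function_Theorem TYPE('a)"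
  unfolding Convex_Function_Theorem_def
proof (intro allI impI ballI, elim conjE)
  fix a b c x t :: 'a and f
  let ?I = "{a<..<b}"
  let ?f' = "derivative ?I f"
  assume diff: "diff_on ?I f ?I" and diff': "diff_on ?I (nth_derivative ?I f 1) ?I"
    and nonneg: "\<forall>z\<in>?I. 0 \<le> nth_derivative ?I f 2 z"
    and t: "t \<in> {c..x}" and cx: "a < c" "c < x" "x < b"
  have d: "has_deriv_at ?I f z (?f' z)" if "z \<in> ?I" for z
    using that by (intro diff_on_derivative[OF diff]) auto
  have mono: "?f' u \<le> ?f' v" if "a < u" "u < v" "v < b" for u v
    using MVT_imp_IFT[OF MVT] diff' nonneg that
    unfolding Increasing_Function_Theorem_def by (simp add: numeral_2_eq_2)
  show "f t \<le> f c + (t - c) * ((f x - f c) / (x - c))"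
  proof (cases "t = c \<or> t = x")
    case True
    then show ?thesis using cx by auto
  next
    case False
    then have ct: "c < t" "t < x" using t by auto
    obtain u where u: "u \<in> {c<..<t}" "?f' u = (f t - f c) / (t - c)"
      using MVT_on_subinterval[OF MVT ct(1), of ?I f ?f'] d cx ct by fastforce
    obtain v where v: "v \<in> {t<..<x}" "?f' v = (f x - f t) / (x - t)"
      using MVT_on_subinterval[OF MVT ct(2), of ?I f ?f'] d cx ct by fastforce
    have "(f t - f c) / (t - c) \<le> (f x - f t) / (x - t)"
      using mono[of u v] u v cx by auto
    then have "(f t - f c) * (x - t) \<le> (f x - f t) * (t - c)"
      using ct by (simp add: divide_le_eq le_divide_eq mult.commute)
    then have "(f t - f c) * (x - c) \<le> (t - c) * (f x - f c)"
      by (simp add: algebra_simps)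
    then have "f t - f c \<le> (t - c) * ((f x - f c) / (x - c))"
      using cx by (simp add: le_divide_eq)
    then show ?thesis by simp
  qed
qed

text \<open>Both \<open>f\<close> and \<open>- f\<close> have nonnegative derivative and are therefore increasing.\<close>

lemma IFT_imp_CVT:
  assumes IFT: "Increasing_Function_Theorem TYPE('a::linordered_field)"
  shows "Constant_Value_Theorem TYPE('a)"
  unfolding Constant_Value_Theorem_def
proof (intro allI impI, elim conjE)
  fix a b :: 'a and f
  let ?I = "{a<..<b}"
  assume diff: "diff_on ?I f ?I" and zero: "\<forall>z\<in>?I. derivative ?I f z = 0"
  have d: "has_deriv_at ?I (\<lambda>x. - f x) z 0" if "z \<in> ?I" for z
    using has_deriv_at_cmult[OF diff_on_derivative[OF diff _ that], of "- 1"] zero that by simp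
  have "diff_on ?I (\<lambda>x. - f x) ?I" using d by (intro diff_onI) auto
  moreover have "derivative ?I (\<lambda>x. - f x) z = 0" if "z \<in> ?I" for z
    using that derivative_eq[OF _ subset_refl _ _ d[OF that]] by auto
  ultimately have dec: "- f c \<le> - f x" if "a < c" "c < x" "x < b" for c x
    using IFT that unfolding Increasing_Function_Theorem_def by (metis order_refl)
  have inc: "f c \<le> f x" if "a < c" "c < x" "x < b" for c x
    using IFT diff zero that unfolding Increasing_Function_Theorem_def by (metis order_refl)
  have "f x = f y" if "x \<in> ?I" "y \<in> ?I" for x y
    using inc[of x y] dec[of x y] inc[of y x] dec[of y x] that
    by (cases x y rule: linorder_cases) auto
  then show "\<exists>k. \<forall>x\<in>?I. f x = k" by blast
qed

section \<open>Recovering suprema: the step function at a gap\<close>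

text \<open>
  The two conditions say that \<open>L\<close> and its complement are a lower and an upper segment, the first
  without a greatest and the second without a least element.
\<close>

definition gap :: "'a::linordered_field set \<Rightarrow> bool" where
  "gap L \<longleftrightarrow> (\<forall>x\<in>L. \<exists>v>x. {..<v} \<subseteq> L) \<and> (\<forall>x. x \<notin> L \<longrightarrow> (\<exists>u<x. {u<..} \<subseteq> - L))"

text \<open>
  The elements that are not upper bounds of \<open>S\<close> have no greatest one, since each lies below a member
  of \<open>S\<close>, and a least upper bound is precisely a least element of the complement.
\<close>

lemma ES_if_no_gap:
  assumes "\<And>L (a::'a::linordered_field) b. gap L \<Longrightarrow> a \<in> L \<Longrightarrow> b \<notin> L \<Longrightarrow> a < b \<Longrightarrow> False"
  shows "Existence_of_Suprema TYPE('a)"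
  unfolding Existence_of_Suprema_def
proof (intro allI impI, elim conjE exE, rule ccontr)
  fix S :: "'a set" and b
  assume "S \<noteq> {}" and b: "upper_bound S b" and none: "\<nexists>c. least_upper_bound S c"
  define L where "L = {x. \<not> upper_bound S x}"
  have "\<exists>v>x. {..<v} \<subseteq> L" if "x \<in> L" for x
    using that by (force simp: L_def upper_bound_def not_le)
  moreover have "\<exists>u<x. {u<..} \<subseteq> - L" if "x \<notin> L" for x
  proof -
    have "\<exists>u<x. upper_bound S u"
      using that none by (auto simp: L_def least_upper_bound_def not_le)
    then show ?thesis by (force simp: L_def upper_bound_def)
  qed
  ultimately have "gap L" by (simp add: gap_def)
  obtain s where "s \<in> S" using \<open>S \<noteq> {}\<close> by blast
  then have "s \<in> L" using none by (auto simp: L_def least_upper_bound_def upper_bound_def)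
  moreover have "b \<notin> L" "s \<le> b" using b \<open>s \<in> S\<close> by (auto simp: L_def upper_bound_def)
  ultimately show False using assms[OF \<open>gap L\<close>, of s b] by (cases "s = b") auto
qed

lemma gap_step_has_deriv_zero:
  assumes "gap L" "c \<in> X"
  shows "has_deriv_at X (\<lambda>x. if x \<in> L then 0 else 1) c 0"
proof (cases "c \<in> L")
  case True
  then obtain v where "v > c" "{..<v} \<subseteq> L" using assms(1) by (auto simp: gap_def)
  then show ?thesis
    by (intro has_deriv_at_local[OF has_deriv_at_const[OF assms(2), of 0], of "c - 1" v]) auto
next
  case False
  then obtain u where "u < c" "{u<..} \<subseteq> - L" using assms(1) unfolding gap_def by blast
  then show ?thesis
    by (intro has_deriv_at_local[OF has_deriv_at_const[OF assms(2), of 1], of u "c + 1"]) auto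
qed

lemma gap_upper_segment:
  assumes "gap L" "b \<notin> L"
  shows "b + 1 \<notin> L"
proof -
  obtain u where "u < b" "{u<..} \<subseteq> - L" using assms unfolding gap_def by blast
  then show ?thesis by (metis ComplD greaterThan_iff less_add_one less_trans subsetD)
qed

lemma PCP_imp_ES:
  assumes PCP: "Polynomial_Characterization_Property TYPE('a::linordered_field)"
  shows "Existence_of_Suprema TYPE('a)"
proof (rule ES_if_no_gap)
  fix L and a b :: 'a assume L: "gap L" "a \<in> L" "b \<notin> L" and ab: "a < b"
  let ?s = "\<lambda>x. if x \<in> L then 0 else 1 :: 'a"
  have sub: "{a<..<b} \<subseteq> {a..b}" by auto
  have d: "has_deriv_at {a..b} ?s x 0" if "x \<in> {a..b}" for x
    using gap_step_has_deriv_zero[OF L(1) that] .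
  have "diff_on {a..b} ?s {a<..<b}" using d by (intro diff_onI[OF sub, of _ "\<lambda>_. 0"]) auto
  moreover have "cont_on {a..b} ?s {a..b}" using has_deriv_at_imp_cont_at[OF d] by (simp add: cont_on_def)
  ultimately have "taylor_hyp 0 a b ?s" by (simp add: taylor_hyp_def)
  moreover have "nth_derivative {a..b} ?s (0 + 1) x = 0" if "x \<in> {a<..<b}" for x
    using derivative_eq[OF ab sub _ _ d] that by simp
  ultimately have "\<exists>p. degree p \<le> 0 \<and> (\<forall>x\<in>{a..b}. ?s x = poly p x)"
    using PCP less_imp_le[OF ab] unfolding Polynomial_Characterization_Property_def by blast
  then obtain p where p: "degree p \<le> 0" "\<forall>x\<in>{a..b}. ?s x = poly p x" by blast
  obtain k where "p = [:k:]" using p(1) degree_eq_zeroE by blast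
  then have "?s a = k" "?s b = k" using p(2) ab by auto
  then show False using L by simp
qed

lemma CVT_imp_ES:
  assumes CVT: "Constant_Value_Theorem TYPE('a::linordered_field)"
  shows "Existence_of_Suprema TYPE('a)"
proof (rule ES_if_no_gap)
  fix L and a b :: 'a assume L: "gap L" "a \<in> L" "b \<notin> L" and ab: "a < b"
  let ?s = "\<lambda>x. if x \<in> L then 0 else 1 :: 'a" and ?I = "{a - 1<..<b + 1}"
  have d: "has_deriv_at ?I ?s x 0" if "x \<in> ?I" for x
    using gap_step_has_deriv_zero[OF L(1) that] .
  have "diff_on ?I ?s ?I" using d by (intro diff_onI) auto
  moreover have "derivative ?I ?s x = 0" if "x \<in> ?I" for x
    using that derivative_eq[OF _ subset_refl _ _ d[OF that]] by auto
  ultimately have "\<exists>k. \<forall>x\<in>?I. ?s x = k"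
    using CVT unfolding Constant_Value_Theorem_def by blast
  then obtain k where k: "\<forall>x\<in>?I. ?s x = k" by blast
  have "a \<in> ?I" "b \<in> ?I" using ab by (auto intro: less_trans[of _ a] less_trans[of _ b])
  then have "?s a = ?s b" using k by metis
  then show False using L by simp
qed

text \<open>
  A convex function that takes the value \<open>0\<close> at \<open>a\<close> and \<open>1\<close> at \<open>b + 1\<close> is less than \<open>1\<close> in between,
  whereas the step function already is \<open>1\<close> at \<open>b\<close>.
\<close>

lemma CFT_imp_ES:
  assumes CFT: "Convex_Function_Theorem TYPE('a::linordered_field)"
  shows "Existence_of_Suprema TYPE('a)"
proof (rule ES_if_no_gap)
  fix L and a b :: 'a assume L: "gap L" "a \<in> L" "b \<notin> L" and ab: "a < b"
  let ?s = "\<lambda>x. if x \<in> L then 0 else 1 :: 'a" and ?I = "{a - 1<..<b + 1 + 1}"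
  have d: "has_deriv_at ?I ?s x 0" if "x \<in> ?I" for x
    using gap_step_has_deriv_zero[OF L(1) that] .
  have s': "derivative ?I ?s x = 0" if "x \<in> ?I" for x
    using that derivative_eq[OF _ subset_refl _ _ d[OF that]] by auto
  have d': "has_deriv_at ?I (derivative ?I ?s) x 0" if "x \<in> ?I" for x
    by (rule has_deriv_at_cong[OF has_deriv_at_const[OF that]]) (rule s')
  have s'': "derivative ?I (derivative ?I ?s) x = 0" if "x \<in> ?I" for x
    using that derivative_eq[OF _ subset_refl _ _ d'[OF that]] by auto
  have "diff_on ?I ?s ?I" using d by (intro diff_onI) auto
  moreover have "diff_on ?I (nth_derivative ?I ?s 1) ?I" using d' by (intro diff_onI) auto
  moreover have "0 \<le> nth_derivative ?I ?s 2 x" if "x \<in> ?I" for x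
    using s''[OF that] by (simp add: numeral_2_eq_2)
  ultimately have conv: "\<forall>c x. a - 1 < c \<and> c < x \<and> x < b + 1 + 1 \<longrightarrow>
      (\<forall>t\<in>{c..x}. ?s t \<le> ?s c + (t - c) * ((?s x - ?s c) / (x - c)))"
    using CFT unfolding Convex_Function_Theorem_def by blast
  have "a < b + 1" "b + 1 \<notin> L" using ab gap_upper_segment[OF L(1,3)] by (auto intro: less_trans[of _ b])
  then have "?s b \<le> ?s a + (b - a) * ((?s (b + 1) - ?s a) / (b + 1 - a))"
    using conv[rule_format, of a "b + 1" b] ab by auto
  then have "1 \<le> (b - a) / (b + 1 - a)" using L \<open>b + 1 \<notin> L\<close> by simp
  then show False using \<open>a < b + 1\<close> by (simp add: le_divide_eq)
qed

lemma connected_imp_ES: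
  assumes conn: "Unit_Interval_Connected TYPE('a::linordered_field)"
  shows "Existence_of_Suprema TYPE('a)"
proof (rule ES_if_no_gap)
  fix L and a b :: 'a assume L: "gap L" "a \<in> L" "b \<notin> L" and ab: "a < b"
  \<comment> \<open>The increasing affine map that takes \<open>0\<close> and \<open>1\<close> to the two sides of the gap.\<close>
  define h where "h = (\<lambda>t. a + t * (b - a))"
  have less: "h t < v \<longleftrightarrow> t < (v - a) / (b - a)" "v < h t \<longleftrightarrow> (v - a) / (b - a) < t" for t v
    using ab by (auto simp: h_def less_divide_eq divide_less_eq)
  have "open_set {t. h t \<in> L}" unfolding open_set_def
  proof
    fix t assume "t \<in> {t. h t \<in> L}"
    then obtain v where v: "v > h t" "{..<v} \<subseteq> L" using L(1) by (auto simp: gap_def)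
    show "\<exists>u v. t \<in> {u<..<v} \<and> {u<..<v} \<subseteq> {t. h t \<in> L}"
      using v less by (intro exI[of _ "t - 1"] exI[of _ "(v - a) / (b - a)"]) auto
  qed
  moreover have "open_set {t. h t \<notin> L}" unfolding open_set_def
  proof
    fix t assume "t \<in> {t. h t \<notin> L}"
    then obtain u where u: "u < h t" "{u<..} \<subseteq> - L" using L(1) unfolding gap_def by blast
    have "h s \<notin> L" if "(u - a) / (b - a) < s" for s
      using subsetD[OF u(2), of "h s"] less(2)[of u s] that by simp
    moreover have "(u - a) / (b - a) < t" "t < t + 1" using u(1) less(2) by simp_all
    ultimately show "\<exists>u v. t \<in> {u<..<v} \<and> {u<..<v} \<subseteq> {t. h t \<notin> L}"
      by (intro exI[of _ "(u - a) / (b - a)"] exI[of _ "t + 1"]) auto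
  qed
  moreover define A B where "A = {t. h t \<in> L} \<inter> {0..1}" and "B = {t. h t \<notin> L} \<inter> {0..1}"
  ultimately have "open_rel {0..1} A" "open_rel {0..1} B" unfolding open_rel_def by blast+
  moreover have "0 \<in> A" "1 \<in> B" using L by (auto simp: A_def B_def h_def)
  moreover have "A \<inter> B = {}" "A \<union> B = {0..1}" by (auto simp: A_def B_def)
  ultimately show False
    using conn unfolding Unit_Interval_Connected_def connected_set_def
    by (metis Un_upper1 Un_upper2 empty_iff)
qed

theorem theorem80:
  shows "(Bolzano_Weierstrass_Property TYPE('a::linordered_field) \<and> Existence_of_Suprema TYPE('a)
            \<longleftrightarrow> Extreme_Value_Theorem TYPE('a))
       \<and> (Extreme_Value_Theorem TYPE('a) \<longleftrightarrow> Rolle_Theorem TYPE('a))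
       \<and> (Rolle_Theorem TYPE('a) \<longleftrightarrow> Extended_Mean_Value_Theorem TYPE('a))
       \<and> (Extended_Mean_Value_Theorem TYPE('a) \<longleftrightarrow> Mean_Value_Theorem TYPE('a))
       \<and> (Mean_Value_Theorem TYPE('a) \<longleftrightarrow> Taylor_Theorem TYPE('a))
       \<and> (Taylor_Theorem TYPE('a) \<longleftrightarrow> Polynomial_Characterization_Property TYPE('a))
       \<and> (Polynomial_Characterization_Property TYPE('a) \<longleftrightarrow> Convex_Function_Theorem TYPE('a))
       \<and> (Convex_Function_Theorem TYPE('a) \<longleftrightarrow> Increasing_Function_Theorem TYPE('a))
       \<and> (Increasing_Function_Theorem TYPE('a) \<longleftrightarrow> Constant_Value_Theorem TYPE('a))
       \<and> (Constant_Value_Theorem TYPE('a) \<longleftrightarrow> Unit_Interval_Connected TYPE('a))"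
  using ES_imp_BWP[where 'a = 'a] ES_imp_EVT[where 'a = 'a] EVT_imp_Rolle[where 'a = 'a]
    Rolle_imp_eMVT[where 'a = 'a] eMVT_imp_MVT[where 'a = 'a] MVT_imp_Rolle[where 'a = 'a]
    Rolle_imp_Taylor[where 'a = 'a] Taylor_imp_PCP[where 'a = 'a] PCP_imp_ES[where 'a = 'a]
    MVT_imp_CFT[where 'a = 'a] CFT_imp_ES[where 'a = 'a]
    MVT_imp_IFT[where 'a = 'a] IFT_imp_CVT[where 'a = 'a] CVT_imp_ES[where 'a = 'a]
    ES_imp_connected[where 'a = 'a] connected_imp_ES[where 'a = 'a]
  by argo

end
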